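(* Let $G$ and $H$ be graphs, let $v_c\in V(G)$, and let $\widetilde{G}$ be a graph obtained from $G$ and $H$ by the $A$-cospectral construction with fixed vertex $v_c$ (defined in the context). Let $\widetilde A$ be the adjacency matrix of $\widetilde G$. Suppose that the eigenvalues of $\widetilde{A}$ induced by $G$ are all simple eigenvalues of $\widetilde{A}$ (i.e. have multiplicity one as eigenvalues of $\widetilde A$). Then the vertices $v_c^1$ and $v_c^2$ are strongly cospectral in $\widetilde G$.
   Context: All graphs (including the constructed ones) are finite, nonempty, undirected, connected, without loops (and without multiple edges). For a graph $G$ and $v_c\in V(G)$, $\mathrm{Aut}(G,v_c)$ is the group of graph automorphisms of $G$ that fix $v_c$, and $[v_j]_{v_c}\subseteq V(G)$ is the orbit of the vertex $v_j$ under the action of $\mathrm{Aut}(G,v_c)$ on $V(G)$. $A$-cospectral construction. Take $H$ together with two copies $G^1, G^2$ of $G$ (all three vertex-disjoint). The copies of a vertex $v_j\in V(G)$ in $G^1$ and $G^2$ are denoted $v_j^1$ and $v_j^2$. Keep all edges of $G^1$, $G^2$, $H$, add no edges between $G^1$ and $G^2$, and add arbitrarily many edges between $V(G^1)$ and $V(H)$ and between $V(G^2)$ and $V(H)$ subject to the following condition: for every added edge between $v_j^1\in V(G^1)$ and $v'_\alpha\in V(H)$, a corresponding edge is added between $v'_\alpha$ and a vertex $v_m^2\in V(G^2)$ with $v_m\in[v_j]_{v_c}$, and these are all the added edges. In other words, for every $v'\in V(H)$ and every orbit $O$ of $\mathrm{Aut}(G,v_c)$ on $V(G)$, the number of neighbours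 of $v'$ in $\{v^1: v\in O\}$ equals the number of neighbours of $v'$ in $\{v^2: v\in O\}$. The resulting graph is $\widetilde G$. For a graph with $n$ vertices, the vertex $v$ is associated with a standard basis vector $\boldsymbol{v}\in\mathbb{R}^n$. For a real symmetric matrix $M$, $\Lambda_M$ is its set of (distinct) eigenvalues. Eigenvalues of $\widetilde A$ induced by $G$: let $A$ be the adjacency matrix of $G$ and let $\boldsymbol{v}_c=\sum_{\lambda\in\Lambda_A}c_\lambda\boldsymbol{w}_\lambda$ be the spectral decomposition of $\boldsymbol{v}_c$, where $\boldsymbol{w}_\lambda$ is an eigenvector of $A$ with eigenvalue $\lambda$. The eigenvalues $\lambda\in\Lambda_A$ with $c_\lambda\neq0$ (equivalently, those for which the orthogonal projection of $\boldsymbol{v}_c$ onto the $\lambda$-eigenspace of $A$ is nonzero) are also eigenvalues of $\widetilde A$, and they are called the eigenvalues of $\widetilde A$ induced by $G$. Two vertices $v_i,v_j$ of a graph with adjacency matrix $A=\sum_{\lambda\in\Lambda_A}\lambda E_\lambda$, where $E_\lambda$ is the orthogonal projection onto the $\lambda$-eigenspace of $A$, are strongly cospectral if for every $\lambda\in\Lambda_A$, $E_\lambda\boldsymbol{v}_i=E_\lambda\boldsymbol{v}_j$ or $E_\lambda\boldsymbol{v}_i=-E_\lambda\boldsymbol{v}_j$. *)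

theory Defs
  imports "HOL-Analysis.Analysis"
begin

text \<open>A finite nonempty graph is given by its adjacency relation on a finite type of vertices.\<close>

definition graph :: "('a::finite \<Rightarrow> 'a \<Rightarrow> bool) \<Rightarrow> bool" where
  "graph E \<longleftrightarrow> symp E \<and> irreflp E \<and> (\<forall>u v. E\<^sup>*\<^sup>* u v)"

definition adjacency_matrix :: "('a::finite \<Rightarrow> 'a \<Rightarrow> bool) \<Rightarrow> real^'a^'a" where
  "adjacency_matrix E = (\<chi> i j. if E i j then 1 else 0)"

abbreviation vertex_vec :: "'a::finite \<Rightarrow> real^'a" where
  "vertex_vec v \<equiv> axis v 1"

definition Aut_fix :: "('a \<Rightarrow> 'a \<Rightarrow> bool) \<Rightarrow> 'a \<Rightarrow> ('a \<Rightarrow> 'a) set" where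
  "Aut_fix E c = {\<pi>. bij \<pi> \<and> (\<forall>u v. E (\<pi> u) (\<pi> v) \<longleftrightarrow> E u v) \<and> \<pi> c = c}"

definition orbit_fix :: "('a \<Rightarrow> 'a \<Rightarrow> bool) \<Rightarrow> 'a \<Rightarrow> 'a \<Rightarrow> 'a set" where
  "orbit_fix E c v = {\<pi> v | \<pi>. \<pi> \<in> Aut_fix E c}"

text \<open>The vertex set of the constructed graph is the disjoint union of two copies of
  the vertex set of \<open>G\<close> and one copy of the vertex set of \<open>H\<close>.\<close>

abbreviation copy1 :: "'a \<Rightarrow> 'a + 'a + 'b" where
  "copy1 v \<equiv> Inl v"

abbreviation copy2 :: "'a \<Rightarrow> 'a + 'a + 'b" where
  "copy2 v \<equiv> Inr (Inl v)"

abbreviation inH :: "'b \<Rightarrow> 'a + 'a + 'b" where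
  "inH w \<equiv> Inr (Inr w)"

text \<open>\<open>A_cospectral_construction G c H T\<close>: the graph \<open>T\<close> is one of the possible results of the
  construction from \<open>G\<close> and \<open>H\<close> with fixed vertex \<open>c\<close>.  The edges between the copies of \<open>G\<close>
  and \<open>H\<close> are constrained by the last conjunct only.\<close>

definition A_cospectral_construction ::
    "('a::finite \<Rightarrow> 'a \<Rightarrow> bool) \<Rightarrow> 'a \<Rightarrow> ('b::finite \<Rightarrow> 'b \<Rightarrow> bool) \<Rightarrow>
     ('a + 'a + 'b \<Rightarrow> 'a + 'a + 'b \<Rightarrow> bool) \<Rightarrow> bool" where
  "A_cospectral_construction G c H T \<longleftrightarrow>
     graph T \<and>
     (\<forall>u v. T (copy1 u) (copy1 v) \<longleftrightarrow> G u v) \<and>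
     (\<forall>u v. T (copy2 u) (copy2 v) \<longleftrightarrow> G u v) \<and>
     (\<forall>u v. T (inH u) (inH v) \<longleftrightarrow> H u v) \<and>
     (\<forall>u v. \<not> T (copy1 u) (copy2 v)) \<and>
     (\<forall>w v. card {u \<in> orbit_fix G c v. T (inH w) (copy1 u)}
          = card {u \<in> orbit_fix G c v. T (inH w) (copy2 u)})"

definition eigenspace :: "real^'n^'n \<Rightarrow> real \<Rightarrow> (real^'n) set" where
  "eigenspace M \<mu> = {x. M *v x = \<mu> *\<^sub>R x}"

definition eigenvalues :: "real^'n^'n \<Rightarrow> real set" where
  "eigenvalues M = {\<mu>. \<exists>x. x \<noteq> 0 \<and> M *v x = \<mu> *\<^sub>R x}"

text \<open>For the symmetric matrices considered here, the multiplicity of an eigenvalue is the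
  dimension of its eigenspace; geometric and algebraic multiplicity agree.\<close>

definition simple_eigenvalue :: "real^'n^'n \<Rightarrow> real \<Rightarrow> bool" where
  "simple_eigenvalue M \<mu> \<longleftrightarrow> \<mu> \<in> eigenvalues M \<and> dim (eigenspace M \<mu>) = 1"

definition orthogonal_projection :: "'a::euclidean_space set \<Rightarrow> 'a \<Rightarrow> 'a" where
  "orthogonal_projection S x = (THE y. y \<in> S \<and> (\<forall>z\<in>S. orthogonal (x - y) z))"

lemma orthogonal_projection_unique:
  fixes S :: "'a::euclidean_space set"
  assumes "subspace S"
  shows "\<exists>!y. y \<in> S \<and> (\<forall>z\<in>S. orthogonal (x - y) z)"
proof -
  obtain y z where yz: "y \<in> span S" "\<And>w. w \<in> span S \<Longrightarrow> orthogonal z w" "x = y + z"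
    using orthogonal_subspace_decomp_exists[of S x] by metis
  have "span S = S"
    using assms by (simp add: span_eq_iff)
  with yz have ex: "y \<in> S \<and> (\<forall>z\<in>S. orthogonal (x - y) z)"
    by auto
  have "y1 = y2" if "y1 \<in> S \<and> (\<forall>z\<in>S. orthogonal (x - y1) z)"
    "y2 \<in> S \<and> (\<forall>z\<in>S. orthogonal (x - y2) z)" for y1 y2
  proof -
    have "y1 - y2 \<in> S"
      using that assms by (blast intro: subspace_diff)
    then have "orthogonal ((x - y2) - (x - y1)) (y1 - y2)"
      using that by (metis orthogonal_clauses(10))
    then show ?thesis
      by (simp add: orthogonal_self)
  qed
  with ex show ?thesis by blast
qed

lemma subspace_eigenspace: "subspace (eigenspace M \<mu>)"
  by (auto simp: subspace_def eigenspace_def matrix_vector_right_distrib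
      scaleR_right_distrib matrix_vector_mult_scaleR)

definition eigenprojection :: "real^'n^'n \<Rightarrow> real \<Rightarrow> real^'n \<Rightarrow> real^'n" where
  "eigenprojection M \<mu> = orthogonal_projection (eigenspace M \<mu>)"

definition induced_eigenvalues :: "('a::finite \<Rightarrow> 'a \<Rightarrow> bool) \<Rightarrow> 'a \<Rightarrow> real set" where
  "induced_eigenvalues G c =
     {\<mu> \<in> eigenvalues (adjacency_matrix G).
        eigenprojection (adjacency_matrix G) \<mu> (vertex_vec c) \<noteq> 0}"

definition strongly_cospectral :: "('a::finite \<Rightarrow> 'a \<Rightarrow> bool) \<Rightarrow> 'a \<Rightarrow> 'a \<Rightarrow> bool" where
  "strongly_cospectral G u v \<longleftrightarrow>
     (\<forall>\<mu> \<in> eigenvalues (adjacency_matrix G).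
        eigenprojection (adjacency_matrix G) \<mu> (vertex_vec u) =
          eigenprojection (adjacency_matrix G) \<mu> (vertex_vec v) \<or>
        eigenprojection (adjacency_matrix G) \<mu> (vertex_vec u) =
          - eigenprojection (adjacency_matrix G) \<mu> (vertex_vec v))"

end

theory Submission
  imports Defs
begin

text \<open>
  Let \<open>A\<close> and \<open>A'\<close> be the adjacency matrices of \<open>G\<close> and of the constructed graph \<open>T\<close>, and let
  \<open>S\<close> be the space of vectors on \<open>V(G)\<close> that are constant on the orbits of \<open>Aut(G, c)\<close>.  For a
  vector \<open>s\<close> on \<open>V(G)\<close> let \<open>D s\<close> be the vector \<open>(s, -s, 0)\<close> on the vertices of \<open>T\<close>.  A vertex of
  \<open>H\<close> has equally many neighbours in the two copies of each orbit, so that for \<open>s \<in> S\<close> the two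
  contributions to \<open>A' (D s)\<close> at this vertex cancel; therefore \<open>A' (D s) = D (A s)\<close>
  (\<open>adjacency_antisymmetric_lift\<close>).

  Consider an eigenvalue \<open>\<mu>\<close> of \<open>A'\<close>.  If every \<open>\<mu>\<close>-eigenvector takes equal values at the two
  copies of \<open>c\<close>, the difference of the two vertex vectors is orthogonal to the eigenspace, and
  the two projections agree.  Otherwise pick a \<open>\<mu>\<close>-eigenvector \<open>z\<close> that separates the two copies,
  and represent the functional \<open>s \<mapsto> \<langle>z, D s\<rangle>\<close> on \<open>S\<close> by a vector \<open>y \<in> S\<close>.  Since \<open>A\<close>
  preserves \<open>S\<close> and \<open>D\<close> intertwines \<open>A\<close> with \<open>A'\<close> there, \<open>y\<close> satisfies \<open>A y = \<mu> y\<close>; and since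
  the vertex vector of \<open>c\<close> lies in \<open>S\<close>, the entry of \<open>y\<close> at \<open>c\<close> is the difference of the values
  of \<open>z\<close> at the two copies, hence nonzero (\<open>invariant_eigenvector_from_separating\<close>).  So
  \<open>\<mu>\<close> is induced by \<open>G\<close>, thus simple by hypothesis, and the line spanned by \<open>D y\<close> is the whole
  eigenspace.  All its elements take opposite values at the two copies of \<open>c\<close>, so that the two
  projections are negatives of each other.
\<close>

section \<open>Orthogonal projections and symmetric matrices\<close>

lemma orthogonal_projection_eqI:
  fixes S :: "'a::euclidean_space set"
  assumes "subspace S" "y \<in> S" "\<And>z. z \<in> S \<Longrightarrow> orthogonal (x - y) z"
  shows "orthogonal_projection S x = y"
  unfolding orthogonal_projection_def
  using orthogonal_projection_unique[OF assms(1), of x] assms(2,3) by (intro the1_equality) auto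

lemma
  fixes S :: "'a::euclidean_space set"
  assumes "subspace S"
  shows orthogonal_projection_in: "orthogonal_projection S x \<in> S"
    and inner_orthogonal_projection: "z \<in> S \<Longrightarrow> orthogonal_projection S x \<bullet> z = x \<bullet> z"
proof -
  have "orthogonal_projection S x \<in> S \<and> (\<forall>z\<in>S. orthogonal (x - orthogonal_projection S x) z)"
    unfolding orthogonal_projection_def
    by (rule theI') (rule orthogonal_projection_unique[OF assms])
  then show "orthogonal_projection S x \<in> S"
    and "z \<in> S \<Longrightarrow> orthogonal_projection S x \<bullet> z = x \<bullet> z"
    by (auto simp: orthogonal_def inner_diff_left)
qed

text \<open>With \<open>k = 1\<close> and \<open>k = -1\<close> this turns entrywise relations between the elements of an
  eigenspace into the two alternatives of strong cospectrality.\<close>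

lemma orthogonal_projection_eq_scaled:
  fixes S :: "'a::euclidean_space set"
  assumes "subspace S" "\<And>z. z \<in> S \<Longrightarrow> x \<bullet> z = k * (y \<bullet> z)"
  shows "orthogonal_projection S x = k *\<^sub>R orthogonal_projection S y"
proof (rule orthogonal_projection_eqI[OF assms(1)])
  show "k *\<^sub>R orthogonal_projection S y \<in> S"
    by (intro subspace_mul orthogonal_projection_in assms(1))
  show "orthogonal (x - k *\<^sub>R orthogonal_projection S y) z" if "z \<in> S" for z
    using assms that by (simp add: orthogonal_def inner_diff_left inner_orthogonal_projection)
qed

lemma adjacency_matrix_self_adjoint:
  assumes "symp E"
  shows "(adjacency_matrix E *v x) \<bullet> y = x \<bullet> (adjacency_matrix E *v y)"
proof -
  have "transpose (adjacency_matrix E) = adjacency_matrix E"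
    using assms by (auto simp: transpose_def adjacency_matrix_def vec_eq_iff dest: sympD)
  then show ?thesis
    by (metis dot_lmul_matrix transpose_matrix_vector)
qed

lemma adjacency_matrix_vector_nth:
  "(adjacency_matrix E *v x) $ i = (\<Sum>j\<in>UNIV. of_bool (E i j) * x $ j)"
  by (simp add: adjacency_matrix_def matrix_vector_mult_def of_bool_def)

section \<open>Vectors that are constant on orbits\<close>

lemma Aut_fix_id: "id \<in> Aut_fix E c"
  by (simp add: Aut_fix_def)

lemma Aut_fix_comp: "p \<in> Aut_fix E c \<Longrightarrow> q \<in> Aut_fix E c \<Longrightarrow> p \<circ> q \<in> Aut_fix E c"
  by (auto simp: Aut_fix_def bij_comp)

lemma Aut_fix_inv: "p \<in> Aut_fix E c \<Longrightarrow> inv p \<in> Aut_fix E c"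
  unfolding Aut_fix_def
  by (auto simp: bij_imp_bij_inv) (metis bij_inv_eq_iff)+

lemma orbit_fixI: "p \<in> Aut_fix E c \<Longrightarrow> p v \<in> orbit_fix E c v"
  unfolding orbit_fix_def by (intro CollectI exI[of _ p]) simp

lemma orbit_fix_eq_iff: "orbit_fix E c u = orbit_fix E c v \<longleftrightarrow> u \<in> orbit_fix E c v"
proof
  assume "orbit_fix E c u = orbit_fix E c v"
  moreover have "u \<in> orbit_fix E c u"
    using orbit_fixI[OF Aut_fix_id] by simp
  ultimately show "u \<in> orbit_fix E c v" by simp
next
  assume "u \<in> orbit_fix E c v"
  then obtain p where p: "p \<in> Aut_fix E c" "u = p v"
    by (auto simp: orbit_fix_def)
  then have v: "v = inv p u"
    by (simp add: Aut_fix_def bij_is_inj)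
  have "q u \<in> orbit_fix E c v" if "q \<in> Aut_fix E c" for q
    using orbit_fixI[OF Aut_fix_comp[OF that p(1)], of v] p(2) by simp
  moreover have "q v \<in> orbit_fix E c u" if "q \<in> Aut_fix E c" for q
    using orbit_fixI[OF Aut_fix_comp[OF that Aut_fix_inv[OF p(1)]], of u] v by simp
  ultimately show "orbit_fix E c u = orbit_fix E c v"
    by (auto simp: orbit_fix_def)
qed

definition invariant_vectors :: "('a::finite \<Rightarrow> 'a \<Rightarrow> bool) \<Rightarrow> 'a \<Rightarrow> (real^'a) set" where
  "invariant_vectors E c = {s. \<forall>p\<in>Aut_fix E c. \<forall>v. s $ p v = s $ v}"

lemma subspace_invariant_vectors: "subspace (invariant_vectors E c)"
  by (auto simp: subspace_def invariant_vectors_def)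

lemma vertex_vec_invariant: "vertex_vec c \<in> invariant_vectors E c"
proof -
  have "p v = c \<longleftrightarrow> v = c" if "p \<in> Aut_fix E c" for p v
    using that by (auto simp: Aut_fix_def dest!: bij_is_inj dest: injD[of p v c])
  then show ?thesis
    by (auto simp: invariant_vectors_def axis_def)
qed

lemma adjacency_matrix_preserves_invariant:
  assumes "s \<in> invariant_vectors E c"
  shows "adjacency_matrix E *v s \<in> invariant_vectors E c"
  unfolding invariant_vectors_def
proof (intro CollectI ballI allI)
  fix p v assume p: "p \<in> Aut_fix E c"
  have "(adjacency_matrix E *v s) $ p v = (\<Sum>u\<in>UNIV. of_bool (E (p v) (p u)) * s $ p u)"
    unfolding adjacency_matrix_vector_nth
    by (rule sum.reindex_bij_betw[symmetric]) (use p in \<open>simp add: Aut_fix_def\<close>)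
  also have "\<dots> = (adjacency_matrix E *v s) $ v"
    using p assms by (simp add: adjacency_matrix_vector_nth Aut_fix_def invariant_vectors_def)
  finally show "(adjacency_matrix E *v s) $ p v = (adjacency_matrix E *v s) $ v" .
qed

text \<open>An invariant vector takes a single value on each orbit, so a sum of its entries over the
  vertices satisfying a predicate depends only on how many of them lie in each orbit.\<close>

lemma sum_invariant_cong_card:
  assumes s: "s \<in> invariant_vectors E c"
    and card: "\<And>v. card {u \<in> orbit_fix E c v. P u} = card {u \<in> orbit_fix E c v. Q u}"
  shows "(\<Sum>u\<in>UNIV. of_bool (P u) * s $ u) = (\<Sum>u\<in>UNIV. of_bool (Q u) * s $ u)"
proof -
  have by_orbits: "(\<Sum>u\<in>UNIV. of_bool (R u) * s $ u) =
      (\<Sum>X\<in>range (orbit_fix E c). \<Sum>u\<in>X. of_bool (R u) * s $ u)" for R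
  proof -
    have "{u \<in> UNIV. orbit_fix E c u = X} = X" if "X \<in> range (orbit_fix E c)" for X
      using that by (elim rangeE) (simp add: orbit_fix_eq_iff)
    moreover have "(\<Sum>u\<in>UNIV. of_bool (R u) * s $ u) = (\<Sum>X\<in>range (orbit_fix E c).
        \<Sum>u\<in>{u \<in> UNIV. orbit_fix E c u = X}. of_bool (R u) * s $ u)"
      by (rule sum.group[symmetric]) auto
    ultimately show ?thesis by simp
  qed
  have on_orbit: "(\<Sum>u\<in>orbit_fix E c v. of_bool (R u) * s $ u) =
      card {u \<in> orbit_fix E c v. R u} * s $ v" for R v
  proof -
    have "s $ u = s $ v" if "u \<in> orbit_fix E c v" for u
      using that s by (auto simp: orbit_fix_def invariant_vectors_def)
    then have "(\<Sum>u\<in>orbit_fix E c v. of_bool (R u) * s $ u) =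
        (\<Sum>u\<in>orbit_fix E c v. of_bool (R u)) * s $ v"
      by (simp add: sum_distrib_right)
    then show ?thesis
      by (simp add: of_bool_def sum.If_cases Int_def)
  qed
  show ?thesis
    unfolding by_orbits by (rule sum.cong[OF refl], elim rangeE) (simp only: on_orbit card)
qed

section \<open>The antisymmetric lift to the constructed graph\<close>

definition antisymmetric_lift :: "real^'a::finite \<Rightarrow> real^('a + 'a + 'b::finite)" where
  "antisymmetric_lift s =
     (\<chi> i. case i of Inl v \<Rightarrow> s $ v | Inr (Inl v) \<Rightarrow> - s $ v | Inr (Inr w) \<Rightarrow> 0)"

lemma antisymmetric_lift_nth [simp]:
  "antisymmetric_lift s $ copy1 v = s $ v"
  "antisymmetric_lift s $ copy2 v = - s $ v"
  "antisymmetric_lift s $ inH w = 0"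
  by (simp_all add: antisymmetric_lift_def)

lemma antisymmetric_lift_linear:
  "antisymmetric_lift (s - t) = antisymmetric_lift s - antisymmetric_lift t"
  "antisymmetric_lift (k *\<^sub>R s) = k *\<^sub>R antisymmetric_lift s"
  by (auto simp: vec_eq_iff antisymmetric_lift_def split: sum.split)

lemma sum_UNIV_sum_type:
  fixes f :: "'a::finite + 'b::finite \<Rightarrow> 'c::comm_monoid_add"
  shows "(\<Sum>i\<in>UNIV. f i) = (\<Sum>v\<in>UNIV. f (Inl v)) + (\<Sum>w\<in>UNIV. f (Inr w))"
  unfolding UNIV_Plus_UNIV[symmetric] by (subst sum.Plus) auto

lemma inner_antisymmetric_lift:
  "z \<bullet> antisymmetric_lift s = (\<chi> v. z $ copy1 v - z $ copy2 v) \<bullet> s"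
  by (simp add: inner_vec_def sum_UNIV_sum_type sum_negf left_diff_distrib sum_subtractf)

lemma adjacency_antisymmetric_lift:
  assumes T: "A_cospectral_construction G c H T" and s: "s \<in> invariant_vectors G c"
  shows "adjacency_matrix T *v antisymmetric_lift s = antisymmetric_lift (adjacency_matrix G *v s)"
proof -
  have sym: "symp T"
    and copies: "\<And>u v. T (copy1 u) (copy1 v) \<longleftrightarrow> G u v" "\<And>u v. T (copy2 u) (copy2 v) \<longleftrightarrow> G u v"
      "\<And>u v. \<not> T (copy1 u) (copy2 v)"
    and card: "\<And>w v. card {u \<in> orbit_fix G c v. T (inH w) (copy1 u)}
          = card {u \<in> orbit_fix G c v. T (inH w) (copy2 u)}"
    using T by (auto simp: A_cospectral_construction_def graph_def)
  have copies': "\<not> T (copy2 u) (copy1 v)" for u v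
    using copies(3) sym by (blast dest: sympD)
  have expand: "(adjacency_matrix T *v antisymmetric_lift s) $ i =
      (\<Sum>u\<in>UNIV. of_bool (T i (copy1 u)) * s $ u) - (\<Sum>u\<in>UNIV. of_bool (T i (copy2 u)) * s $ u)"
    for i
    by (simp add: adjacency_matrix_vector_nth sum_UNIV_sum_type sum_negf)
  have "(adjacency_matrix T *v antisymmetric_lift s) $ i =
      antisymmetric_lift (adjacency_matrix G *v s) $ i" for i
  proof -
    consider v where "i = copy1 v" | v where "i = copy2 v" | w where "i = inH w"
      by (metis sum.exhaust)
    then show ?thesis
    proof cases
      case 3
      then show ?thesis
        using sum_invariant_cong_card[OF s card] by (simp add: expand)
    qed (simp_all only: expand, simp_all add: copies copies' adjacency_matrix_vector_nth)
  qed
  then show ?thesis by (simp add: vec_eq_iff)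
qed

section \<open>Eigenvalues whose eigenvectors separate the two copies\<close>

text \<open>The compression of \<open>z\<close> to the invariant vectors is an eigenvector of \<open>G\<close>: on that subspace
  the lift intertwines the two adjacency matrices, and by self-adjointness its adjoint carries
  eigenvectors back.\<close>

lemma invariant_eigenvector_from_separating:
  assumes G: "graph G" and T: "A_cospectral_construction G c H T"
    and z: "z \<in> eigenspace (adjacency_matrix T) \<mu>" "z $ copy1 c \<noteq> z $ copy2 c"
  obtains y where "y \<in> invariant_vectors G c" "y \<in> eigenspace (adjacency_matrix G) \<mu>" "y $ c \<noteq> 0"
proof
  let ?A = "adjacency_matrix G" and ?B = "adjacency_matrix T" and ?S = "invariant_vectors G c"
  let ?D = "antisymmetric_lift :: real^'a \<Rightarrow> real^('a + 'a + 'b)"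
  define y where "y = orthogonal_projection ?S (\<chi> v. z $ copy1 v - z $ copy2 v)"
  have symG: "symp G" and symT: "symp T"
    using G T by (auto simp: A_cospectral_construction_def graph_def)
  show yS: "y \<in> ?S"
    unfolding y_def by (intro orthogonal_projection_in subspace_invariant_vectors)
  have y_inner: "y \<bullet> s = z \<bullet> ?D s" if "s \<in> ?S" for s
    unfolding y_def inner_antisymmetric_lift
    by (intro inner_orthogonal_projection subspace_invariant_vectors that)
  have shift_S: "?A *v s - \<mu> *\<^sub>R s \<in> ?S" if "s \<in> ?S" for s
    using that subspace_invariant_vectors
    by (intro subspace_diff subspace_mul adjacency_matrix_preserves_invariant)
  have "(?A *v y - \<mu> *\<^sub>R y) \<bullet> s = 0" if s: "s \<in> ?S" for s
  proof -
    have "(?A *v y - \<mu> *\<^sub>R y) \<bullet> s = y \<bullet> (?A *v s - \<mu> *\<^sub>R s)"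
      by (simp add: inner_diff adjacency_matrix_self_adjoint[OF symG])
    also have "\<dots> = z \<bullet> (?B *v ?D s - \<mu> *\<^sub>R ?D s)"
      using y_inner[OF shift_S[OF s]]
      by (simp add: antisymmetric_lift_linear adjacency_antisymmetric_lift[OF T s])
    also have "\<dots> = (?B *v z - \<mu> *\<^sub>R z) \<bullet> ?D s"
      by (simp add: inner_diff adjacency_matrix_self_adjoint[OF symT])
    also have "\<dots> = 0"
      using z(1) by (simp add: eigenspace_def)
    finally show ?thesis .
  qed
  \<comment> \<open>The defect lies in the invariant subspace itself and is orthogonal to it.\<close>
  from this[OF shift_S[OF yS]] show "y \<in> eigenspace ?A \<mu>"
    by (simp add: eigenspace_def)
  have "y $ c = z $ copy1 c - z $ copy2 c"
    using y_inner[OF vertex_vec_invariant] by (simp add: inner_antisymmetric_lift inner_axis)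
  with z(2) show "y $ c \<noteq> 0" by simp
qed

text \<open>A vertex vector whose projection vanished would be orthogonal to the eigenspace, but its
  inner product with \<open>y\<close> is the entry \<open>y $ c\<close>.\<close>

lemma induced_eigenvaluesI:
  assumes "y \<in> eigenspace (adjacency_matrix G) \<mu>" "y $ c \<noteq> 0"
  shows "\<mu> \<in> induced_eigenvalues G c"
proof -
  have "eigenprojection (adjacency_matrix G) \<mu> (vertex_vec c) \<bullet> y = y $ c"
    unfolding eigenprojection_def
    using inner_orthogonal_projection[OF subspace_eigenspace assms(1), of "vertex_vec c"]
    by (simp add: inner_axis')
  moreover have "y \<noteq> 0"
    using assms(2) by auto
  ultimately show ?thesis
    using assms by (auto simp: induced_eigenvalues_def eigenvalues_def eigenspace_def)
qed

lemma simple_eigenspace_multiple: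
  assumes "simple_eigenvalue M \<mu>" "x \<in> eigenspace M \<mu>" "x \<noteq> 0" "z \<in> eigenspace M \<mu>"
  obtains k where "z = k *\<^sub>R x"
proof -
  have "eigenspace M \<mu> \<subseteq> span {x}"
    using assms by (intro card_ge_dim_independent)
      (auto simp: simple_eigenvalue_def dim_le_card independent_insert)
  with assms(4) that show thesis
    by (auto simp: span_singleton)
qed

theorem theorem4p5:
  fixes G :: "'a::finite \<Rightarrow> 'a \<Rightarrow> bool"
    and H :: "'b::finite \<Rightarrow> 'b \<Rightarrow> bool"
    and T :: "'a + 'a + 'b \<Rightarrow> 'a + 'a + 'b \<Rightarrow> bool"
    and c :: 'a
  assumes "graph G"
    and "graph H"
    and "A_cospectral_construction G c H T"
    and "\<forall>\<mu> \<in> induced_eigenvalues G c. simple_eigenvalue (adjacency_matrix T) \<mu>"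
  shows "strongly_cospectral T (copy1 c) (copy2 c)"
  unfolding strongly_cospectral_def
proof
  fix \<mu>
  let ?U = "eigenspace (adjacency_matrix T) \<mu>"
  let ?P = "eigenprojection (adjacency_matrix T) \<mu>"
  note scaled = orthogonal_projection_eq_scaled[OF subspace_eigenspace[of "adjacency_matrix T" \<mu>],
      of "vertex_vec (copy1 c)" _ "vertex_vec (copy2 c)", folded eigenprojection_def]
  show "?P (vertex_vec (copy1 c)) = ?P (vertex_vec (copy2 c)) \<or>
      ?P (vertex_vec (copy1 c)) = - ?P (vertex_vec (copy2 c))"
  proof (cases "\<forall>z\<in>?U. z $ copy1 c = z $ copy2 c")
    case True
    then show ?thesis
      using scaled[of 1] by (simp add: inner_axis')
  next
    case False
    then obtain y where y: "y \<in> invariant_vectors G c" "y \<in> eigenspace (adjacency_matrix G) \<mu>"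
        "y $ c \<noteq> 0"
      using invariant_eigenvector_from_separating[OF assms(1,3)] by blast
    let ?x = "antisymmetric_lift y :: real^('a + 'a + 'b)"
    have simple: "simple_eigenvalue (adjacency_matrix T) \<mu>"
      using assms(4) induced_eigenvaluesI[OF y(2,3)] by blast
    have x: "?x \<in> ?U"
      using y(2) adjacency_antisymmetric_lift[OF assms(3) y(1)]
      by (simp add: eigenspace_def antisymmetric_lift_linear)
    have "?x $ copy1 c \<noteq> 0"
      using y(3) by simp
    then have "?x \<noteq> 0"
      by (metis zero_index)
    then have "z $ copy1 c = - z $ copy2 c" if "z \<in> ?U" for z
      using simple_eigenspace_multiple[OF simple x _ that] by force
    then show ?thesis
      using scaled[of "- 1"] by (simp add: inner_axis')
  qed
qed

end
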